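(* Let $\Sigma=(X,X_0,S,U,\to,Y,h)$ be a total NFTS and $\Sigma_V$ its verification system with state set $X_V$. Then $\Sigma$ is infinite-step opaque if and only if for every $(q^1,q^2)\in X_V$: if $q^1\cap q^2\neq\emptyset$ then $q^1\cap q^2\not\subseteq S$.
   Context: An NFTS is a tuple $\Sigma=(X,X_0,S,U,\to,Y,h)$ with $X$ a finite set of states, $X_0\subseteq X$ initial states, $S\subseteq X$ secret states, $U$ a finite set of inputs, $\to\subseteq X\times U\times X$ the transition relation (write $x\xrightarrow{u}x'$), $Y$ a set of outputs and $h:X\to Y$. It is total if for every $x\in X$, $u\in U$ there is $x'$ with $x\xrightarrow{u}x'$. For $\alpha=\alpha(0)\cdots\alpha(|\alpha|-1)\in U^*$ (finite sequences, including empty), a run over $\alpha$ is a nonempty sequence $x_0\dots x_k$ with $k\le|\alpha|$, $x_0\in X_0$, $(x_j,\alpha(j),x_{j+1})\in\to$ for $j<k$; it is maximal if $k=|\alpha|$ or no $x'$ satisfies $(x_k,\alpha(k),x')\in\to$. $\Sigma$ is infinite-step opaque if for every $\alpha\in U^*$, every maximal run $x_0\dots x_k$ over $\alpha$ and every $i\in\{0,\dots,k\}$ with $x_i\in S$, there is a maximal run $x_0'\dots x_k'$ over $\alpha$ with $x_i'\notin S$ and $h(x_j)=h(x_j')$ for all $j\in\{0,\dots,k\}$. For $y\in Y$ let $X_y=\{x\mid h(x)=y\}$, $X_{0,y}=X_0\cap X_y$; for $q\subseteq X$, $u\in U$, $\mathrm{suc}(q,u)=\{x\mid\exists x'\in q,(x',u,x)\in\to\}$,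 $\mathrm{post}(q,u)=\{x\mid\exists x'\in q,(x,u,x')\in\to\}$. Let $\epsilon\notin U$. The verification system $\Sigma_V$ has input set $U_V=(U\times\{\epsilon\})\cup(\{\epsilon\}\times U)$, initial states $X_{V,0}=\{(X_{0,y_1},X_{y_2})\mid y_1,y_2\in Y,\ X_{0,y_1}\neq\emptyset,\ X_{y_2}\neq\emptyset\}$, transitions $(q_1,q_2)\xrightarrow{(u,\epsilon)}_V(q_1',q_2)$ iff $q_1'=\mathrm{suc}(q_1,u)\cap X_y\neq\emptyset$ for some $y\in Y$, and $(q_1,q_2)\xrightarrow{(\epsilon,u)}_V(q_1,q_2')$ iff $q_2'=\mathrm{post}(q_2,u)\cap X_y\neq\emptyset$ for some $y\in Y$; its state set $X_V$ is the set of pairs reachable from $X_{V,0}$ by finitely many transitions. *)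

theory Defs
  imports "HOL-Library.FuncSet"
begin

record ('x, 'u, 'y) nfts_data =
  states :: "'x set"
  inits :: "'x set"
  secrets :: "'x set"
  inputs :: "'u set"
  transitions :: "('x \<times> 'u \<times> 'x) set"
  outputs :: "'y set"
  obs :: "'x \<Rightarrow> 'y"

definition nfts :: "('x, 'u, 'y) nfts_data \<Rightarrow> bool" where
  "nfts \<Sigma> \<longleftrightarrow>
     finite (states \<Sigma>) \<and>
     inits \<Sigma> \<subseteq> states \<Sigma> \<and>
     secrets \<Sigma> \<subseteq> states \<Sigma> \<and>
     finite (inputs \<Sigma>) \<and>
     transitions \<Sigma> \<subseteq> states \<Sigma> \<times> inputs \<Sigma> \<times> states \<Sigma> \<and>
     obs \<Sigma> \<in> states \<Sigma> \<rightarrow> outputs \<Sigma>"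

definition total_nfts :: "('x, 'u, 'y) nfts_data \<Rightarrow> bool" where
  "total_nfts \<Sigma> \<longleftrightarrow> nfts \<Sigma> \<and>
     (\<forall>x\<in>states \<Sigma>. \<forall>u\<in>inputs \<Sigma>. \<exists>x'. (x, u, x') \<in> transitions \<Sigma>)"

text \<open>A run $x_0 \ldots x_k$ is the list of its states, so $k$ is the length of the list minus one.\<close>

definition run :: "('x, 'u, 'y) nfts_data \<Rightarrow> 'u list \<Rightarrow> 'x list \<Rightarrow> bool" where
  "run \<Sigma> \<alpha> xs \<longleftrightarrow>
     xs \<noteq> [] \<and> length xs - 1 \<le> length \<alpha> \<and> xs ! 0 \<in> inits \<Sigma> \<and>
     (\<forall>j < length xs - 1. (xs ! j, \<alpha> ! j, xs ! (j + 1)) \<in> transitions \<Sigma>)"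

definition maximal_run :: "('x, 'u, 'y) nfts_data \<Rightarrow> 'u list \<Rightarrow> 'x list \<Rightarrow> bool" where
  "maximal_run \<Sigma> \<alpha> xs \<longleftrightarrow> run \<Sigma> \<alpha> xs \<and>
     (let k = length xs - 1 in
        k = length \<alpha> \<or> \<not> (\<exists>x'. (xs ! k, \<alpha> ! k, x') \<in> transitions \<Sigma>))"

definition infinite_step_opaque :: "('x, 'u, 'y) nfts_data \<Rightarrow> bool" where
  "infinite_step_opaque \<Sigma> \<longleftrightarrow>
     (\<forall>\<alpha>\<in>lists (inputs \<Sigma>). \<forall>xs. maximal_run \<Sigma> \<alpha> xs \<longrightarrow>
        (\<forall>i < length xs. xs ! i \<in> secrets \<Sigma> \<longrightarrow>
           (\<exists>xs'. maximal_run \<Sigma> \<alpha> xs' \<and> length xs' = length xs \<and>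
              xs' ! i \<notin> secrets \<Sigma> \<and>
              (\<forall>j < length xs. obs \<Sigma> (xs ! j) = obs \<Sigma> (xs' ! j)))))"

definition states_at :: "('x, 'u, 'y) nfts_data \<Rightarrow> 'y \<Rightarrow> 'x set" where
  "states_at \<Sigma> y = {x \<in> states \<Sigma>. obs \<Sigma> x = y}"

definition inits_at :: "('x, 'u, 'y) nfts_data \<Rightarrow> 'y \<Rightarrow> 'x set" where
  "inits_at \<Sigma> y = inits \<Sigma> \<inter> states_at \<Sigma> y"

definition suc :: "('x, 'u, 'y) nfts_data \<Rightarrow> 'x set \<Rightarrow> 'u \<Rightarrow> 'x set" where
  "suc \<Sigma> q u = {x. \<exists>x'\<in>q. (x', u, x) \<in> transitions \<Sigma>}"

text \<open>Despite its name, \<open>post\<close> yields predecessors: the second component of the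
  verification system runs backwards in time.\<close>

definition post :: "('x, 'u, 'y) nfts_data \<Rightarrow> 'x set \<Rightarrow> 'u \<Rightarrow> 'x set" where
  "post \<Sigma> q u = {x. \<exists>x'\<in>q. (x, u, x') \<in> transitions \<Sigma>}"

text \<open>In the inputs of the verification system, \<open>None\<close> plays the role of the fresh
  symbol $\epsilon \notin U$ and \<open>Some u\<close> that of $u \in U$.\<close>

definition ver_inputs :: "('x, 'u, 'y) nfts_data \<Rightarrow> ('u option \<times> 'u option) set" where
  "ver_inputs \<Sigma> = (Some ` inputs \<Sigma> \<times> {None}) \<union> ({None} \<times> Some ` inputs \<Sigma>)"

definition ver_inits :: "('x, 'u, 'y) nfts_data \<Rightarrow> ('x set \<times> 'x set) set" where
  "ver_inits \<Sigma> = {(inits_at \<Sigma> y\<^sub>1, states_at \<Sigma> y\<^sub>2) | y\<^sub>1 y\<^sub>2.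
     y\<^sub>1 \<in> outputs \<Sigma> \<and> y\<^sub>2 \<in> outputs \<Sigma> \<and>
     inits_at \<Sigma> y\<^sub>1 \<noteq> {} \<and> states_at \<Sigma> y\<^sub>2 \<noteq> {}}"

inductive ver_step ::
  "('x, 'u, 'y) nfts_data \<Rightarrow> 'x set \<times> 'x set \<Rightarrow> 'u option \<times> 'u option \<Rightarrow> 'x set \<times> 'x set \<Rightarrow> bool"
  for \<Sigma> where
  forward: "\<lbrakk>u \<in> inputs \<Sigma>; y \<in> outputs \<Sigma>; q\<^sub>1' = suc \<Sigma> q\<^sub>1 u \<inter> states_at \<Sigma> y; q\<^sub>1' \<noteq> {}\<rbrakk>
    \<Longrightarrow> ver_step \<Sigma> (q\<^sub>1, q\<^sub>2) (Some u, None) (q\<^sub>1', q\<^sub>2)"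
| backward: "\<lbrakk>u \<in> inputs \<Sigma>; y \<in> outputs \<Sigma>; q\<^sub>2' = post \<Sigma> q\<^sub>2 u \<inter> states_at \<Sigma> y; q\<^sub>2' \<noteq> {}\<rbrakk>
    \<Longrightarrow> ver_step \<Sigma> (q\<^sub>1, q\<^sub>2) (None, Some u) (q\<^sub>1, q\<^sub>2')"

inductive_set ver_states :: "('x, 'u, 'y) nfts_data \<Rightarrow> ('x set \<times> 'x set) set"
  for \<Sigma> where
  init: "p \<in> ver_inits \<Sigma> \<Longrightarrow> p \<in> ver_states \<Sigma>"
| step: "\<lbrakk>p \<in> ver_states \<Sigma>; w \<in> ver_inputs \<Sigma>; ver_step \<Sigma> p w p'\<rbrakk> \<Longrightarrow> p' \<in> ver_states \<Sigma>"

end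

theory Submission
  imports Defs
begin

text \<open>The reachable states of the verification system are exactly the pairs of a forward
  estimate (the states in which a run over \<open>\<alpha>\<close> with observation \<open>ys\<close> can end) and a backward
  estimate (the states from which a path over \<open>\<beta>\<close> with observation \<open>zs\<close> can start), both
  nonempty. When the two estimates meet, the observations \<open>ys\<close> and \<open>zs\<close> agree at the junction, and
  gluing a run to a path shows that the intersection is the set of states that a run over
  \<open>\<alpha> @ \<beta>\<close> with the glued observation can occupy at time \<open>length \<alpha>\<close>. Totality makes the
  maximal runs over \<open>\<alpha> @ \<beta>\<close> the full-length ones, so opacity says that no such set is
  nonempty and contained in the secret states.\<close>

text \<open>Unlike \<open>run\<close>, a path has full length and may start anywhere, so the same
  notion serves both estimates. Membership in \<open>states\<close> is explicit because a one-state
  path has no transition that would force it.\<close>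

definition path :: "('x, 'u, 'y) nfts_data \<Rightarrow> 'u list \<Rightarrow> 'x list \<Rightarrow> bool" where
  "path \<Sigma> \<alpha> xs \<longleftrightarrow> length xs = Suc (length \<alpha>) \<and> set xs \<subseteq> states \<Sigma> \<and>
     (\<forall>j < length \<alpha>. (xs ! j, \<alpha> ! j, xs ! Suc j) \<in> transitions \<Sigma>)"

definition forward_estimate :: "('x, 'u, 'y) nfts_data \<Rightarrow> 'u list \<Rightarrow> 'y list \<Rightarrow> 'x set" where
  "forward_estimate \<Sigma> \<alpha> ys =
     {xs ! length \<alpha> | xs. path \<Sigma> \<alpha> xs \<and> xs ! 0 \<in> inits \<Sigma> \<and> map (obs \<Sigma>) xs = ys}"

text \<open>No initial condition appears here: the second component of an initial state of the
  verification system is a whole output class.\<close>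

definition backward_estimate :: "('x, 'u, 'y) nfts_data \<Rightarrow> 'u list \<Rightarrow> 'y list \<Rightarrow> 'x set" where
  "backward_estimate \<Sigma> \<beta> zs = {xs ! 0 | xs. path \<Sigma> \<beta> xs \<and> map (obs \<Sigma>) xs = zs}"

section \<open>Extending, cutting and gluing paths\<close>

lemma path_Nil [simp]: "path \<Sigma> [] xs \<longleftrightarrow> (\<exists>x\<in>states \<Sigma>. xs = [x])"
  by (auto simp: path_def length_Suc_conv)

lemma path_length: "path \<Sigma> \<alpha> xs \<Longrightarrow> length xs = Suc (length \<alpha>)"
  by (simp add: path_def)

lemma path_snoc:
  "path \<Sigma> (\<alpha> @ [u]) (xs @ [x]) \<longleftrightarrow>
     path \<Sigma> \<alpha> xs \<and> x \<in> states \<Sigma> \<and> (xs ! length \<alpha>, u, x) \<in> transitions \<Sigma>"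
  by (auto simp: path_def nth_append less_Suc_eq split: if_splits)

lemma path_Cons:
  "path \<Sigma> (u # \<beta>) (x # xs) \<longleftrightarrow>
     path \<Sigma> \<beta> xs \<and> x \<in> states \<Sigma> \<and> (x, u, xs ! 0) \<in> transitions \<Sigma>"
  by (auto simp: path_def All_less_Suc2)

lemma path_take:
  assumes "path \<Sigma> (\<alpha> @ \<beta>) xs"
  shows "path \<Sigma> \<alpha> (take (Suc (length \<alpha>)) xs)"
proof -
  have "(xs ! j, \<alpha> ! j, xs ! Suc j) \<in> transitions \<Sigma>" if "j < length \<alpha>" for j
    using assms that unfolding path_def
    by (metis length_append nth_append trans_less_add1)
  with assms show ?thesis
    by (auto simp: path_def dest: in_set_takeD)
qed

lemma path_drop:
  assumes "path \<Sigma> (\<alpha> @ \<beta>) xs"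
  shows "path \<Sigma> \<beta> (drop (length \<alpha>) xs)"
proof -
  have "(xs ! (length \<alpha> + j), \<beta> ! j, xs ! Suc (length \<alpha> + j)) \<in> transitions \<Sigma>"
    if "j < length \<beta>" for j
    using assms that unfolding path_def
    by (metis length_append nat_add_left_cancel_less nth_append_length_plus)
  with assms show ?thesis
    by (auto simp: path_def dest: in_set_dropD)
qed

text \<open>The last state of \<open>xs\<close> is the first state of \<open>xs'\<close>;
  \<open>tl\<close> keeps this junction from being listed twice.\<close>

lemma path_glue:
  assumes "path \<Sigma> \<alpha> xs" "path \<Sigma> \<beta> xs'" "xs ! length \<alpha> = xs' ! 0"
  shows "path \<Sigma> (\<alpha> @ \<beta>) (xs @ tl xs')"
proof -
  have "((xs @ tl xs') ! j, (\<alpha> @ \<beta>) ! j, (xs @ tl xs') ! Suc j) \<in> transitions \<Sigma>"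
    if j: "j < length \<alpha> + length \<beta>" for j
  proof (cases "j < length \<alpha>")
    case True
    with assms show ?thesis by (simp add: path_def nth_append)
  next
    case False
    then obtain i where i: "j = length \<alpha> + i" "i < length \<beta>"
      using j by (metis le_iff_add nat_add_left_cancel_less not_less)
    \<comment> \<open>For \<open>i = 0\<close> the entry is the last one of \<open>xs\<close>, and
      the junction hypothesis identifies it with \<open>xs' ! 0\<close>; for larger \<open>i\<close>
      it already lies in \<open>tl xs'\<close>.\<close>
    have "(xs @ tl xs') ! j = xs' ! i"
      using assms i by (cases i) (auto simp: path_def nth_append nth_tl)
    moreover have "(xs @ tl xs') ! Suc j = xs' ! Suc i"
      using assms i by (auto simp: path_def nth_append nth_tl)
    ultimately show ?thesis
      using assms i by (simp add: path_def)
  qed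
  moreover have "set (xs @ tl xs') \<subseteq> states \<Sigma>"
    using assms(1,2) by (cases xs') (auto simp: path_def)
  moreover have "length (xs @ tl xs') = Suc (length (\<alpha> @ \<beta>))"
    using assms(1,2) by (simp add: path_length)
  ultimately show ?thesis
    by (simp add: path_def)
qed

section \<open>Recursion equations of the estimates\<close>

lemma forward_estimate_Nil:
  assumes "nfts \<Sigma>"
  shows "forward_estimate \<Sigma> [] [y] = inits_at \<Sigma> y"
proof -
  have "inits \<Sigma> \<subseteq> states \<Sigma>" using assms by (simp add: nfts_def)
  then show ?thesis by (force simp: forward_estimate_def inits_at_def states_at_def)
qed

text \<open>The right-hand side is the update made by a forward transition: a run grows at its end.
  If \<open>ys\<close> does not fit the length of \<open>\<alpha>\<close>, both sides are
  empty.\<close>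

lemma forward_estimate_snoc:
  "forward_estimate \<Sigma> (\<alpha> @ [u]) (ys @ [y]) = suc \<Sigma> (forward_estimate \<Sigma> \<alpha> ys) u \<inter> states_at \<Sigma> y"
  (is "?L = ?R")
proof (intro equalityI subsetI)
  fix x assume "x \<in> ?L"
  then obtain zs where zs: "path \<Sigma> (\<alpha> @ [u]) zs" "zs ! 0 \<in> inits \<Sigma>" "map (obs \<Sigma>) zs = ys @ [y]"
      "x = zs ! length (\<alpha> @ [u])"
    by (auto simp: forward_estimate_def)
  then obtain xs x' where eq: "zs = xs @ [x']"
    by (cases zs rule: rev_cases) auto
  have len: "length xs = Suc (length \<alpha>)"
    using path_length[OF zs(1)] eq by simp
  show "x \<in> ?R"
    using zs eq len
    by (auto simp: path_snoc suc_def states_at_def forward_estimate_def nth_append)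
next
  fix x assume "x \<in> ?R"
  then obtain xs where xs: "path \<Sigma> \<alpha> xs" "xs ! 0 \<in> inits \<Sigma>" "map (obs \<Sigma>) xs = ys"
      "(xs ! length \<alpha>, u, x) \<in> transitions \<Sigma>" "x \<in> states \<Sigma>" "obs \<Sigma> x = y"
    by (auto simp: suc_def states_at_def forward_estimate_def)
  then show "x \<in> ?L"
    unfolding forward_estimate_def
    by (intro CollectI exI[of _ "xs @ [x]"]) (auto simp: path_snoc nth_append path_length)
qed

lemma backward_estimate_Nil: "backward_estimate \<Sigma> [] [z] = states_at \<Sigma> z"
  by (force simp: backward_estimate_def states_at_def)

text \<open>The mirror image: a backward transition puts a new first state in front of the path, so
  both words grow at the head.\<close>

lemma backward_estimate_Cons:
  "backward_estimate \<Sigma> (u # \<beta>) (z # zs) = post \<Sigma> (backward_estimate \<Sigma> \<beta> zs) u \<inter> states_at \<Sigma> z"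
  (is "?L = ?R")
proof (intro equalityI subsetI)
  fix x assume "x \<in> ?L"
  then obtain xs where "path \<Sigma> (u # \<beta>) (x # xs)" "map (obs \<Sigma>) (x # xs) = z # zs"
    by (auto simp: backward_estimate_def)
  then show "x \<in> ?R"
    by (auto simp: path_Cons post_def states_at_def backward_estimate_def)
next
  fix x assume "x \<in> ?R"
  then obtain xs where "path \<Sigma> \<beta> xs" "map (obs \<Sigma>) xs = zs"
      "(x, u, xs ! 0) \<in> transitions \<Sigma>" "x \<in> states \<Sigma>" "obs \<Sigma> x = z"
    by (auto simp: post_def states_at_def backward_estimate_def)
  then show "x \<in> ?L"
    unfolding backward_estimate_def
    by (intro CollectI exI[of _ "x # xs"]) (auto simp: path_Cons)
qed

lemma forward_estimate_length:
  "x \<in> forward_estimate \<Sigma> \<alpha> ys \<Longrightarrow> length ys = Suc (length \<alpha>)"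
  by (auto simp: forward_estimate_def path_length)

lemma backward_estimate_length:
  "x \<in> backward_estimate \<Sigma> \<beta> zs \<Longrightarrow> length zs = Suc (length \<beta>)"
  by (auto simp: backward_estimate_def path_length)

lemma forward_estimate_obs: "x \<in> forward_estimate \<Sigma> \<alpha> ys \<Longrightarrow> obs \<Sigma> x = ys ! length \<alpha>"
  by (auto simp: forward_estimate_def path_length)

lemma backward_estimate_obs: "x \<in> backward_estimate \<Sigma> \<beta> zs \<Longrightarrow> obs \<Sigma> x = zs ! 0"
  by (auto simp: backward_estimate_def path_length)

section \<open>Reachable states of the verification system\<close>

text \<open>Each transition changes one component only: a forward one appends its letter to
  \<open>\<alpha>\<close>, a backward one prepends its letter to \<open>\<beta>\<close>, and the
  recursion equations follow suit.\<close>

lemma ver_states_are_estimates: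
  assumes "nfts \<Sigma>" "p \<in> ver_states \<Sigma>"
  shows "\<exists>\<alpha>\<in>lists (inputs \<Sigma>). \<exists>\<beta>\<in>lists (inputs \<Sigma>). \<exists>ys zs.
    p = (forward_estimate \<Sigma> \<alpha> ys, backward_estimate \<Sigma> \<beta> zs)"
  using assms(2)
proof induction
  case (init p)
  then obtain y z where "p = (forward_estimate \<Sigma> [] [y], backward_estimate \<Sigma> [] [z])"
    by (auto simp: ver_inits_def forward_estimate_Nil[OF assms(1)] backward_estimate_Nil)
  then show ?case by blast
next
  case (step p w p')
  then obtain \<alpha> \<beta> ys zs where IH: "\<alpha> \<in> lists (inputs \<Sigma>)" "\<beta> \<in> lists (inputs \<Sigma>)"
      "p = (forward_estimate \<Sigma> \<alpha> ys, backward_estimate \<Sigma> \<beta> zs)"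
    by blast
  from step.hyps(3) show ?case
  proof cases
    case (forward u y q\<^sub>1' q\<^sub>1 q\<^sub>2)
    then have "p' = (forward_estimate \<Sigma> (\<alpha> @ [u]) (ys @ [y]), backward_estimate \<Sigma> \<beta> zs)"
      using IH by (simp add: forward_estimate_snoc)
    moreover have "\<alpha> @ [u] \<in> lists (inputs \<Sigma>)"
      using IH forward by simp
    ultimately show ?thesis using IH(2) by blast
  next
    case (backward u y q\<^sub>2' q\<^sub>2 q\<^sub>1)
    then have "p' = (forward_estimate \<Sigma> \<alpha> ys, backward_estimate \<Sigma> (u # \<beta>) (y # zs))"
      using IH by (simp add: backward_estimate_Cons)
    moreover have "u # \<beta> \<in> lists (inputs \<Sigma>)"
      using IH backward by simp
    ultimately show ?thesis using IH(1) by blast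
  qed
qed

lemma states_at_outputs: "nfts \<Sigma> \<Longrightarrow> states_at \<Sigma> y \<noteq> {} \<Longrightarrow> y \<in> outputs \<Sigma>"
  by (auto simp: states_at_def nfts_def)

text \<open>First half of the converse: all forward transitions are taken while the second component
  rests at an initial output class. The backward transitions come afterwards, in
  \<open>estimates_ver_states\<close>.\<close>

lemma forward_estimate_ver_states:
  assumes "nfts \<Sigma>" "states_at \<Sigma> z \<noteq> {}"
    and "\<alpha> \<in> lists (inputs \<Sigma>)" "forward_estimate \<Sigma> \<alpha> ys \<noteq> {}"
  shows "(forward_estimate \<Sigma> \<alpha> ys, states_at \<Sigma> z) \<in> ver_states \<Sigma>"
  using assms(3,4)
proof (induction \<alpha> arbitrary: ys rule: rev_induct)
  case Nil
  then obtain y where ys: "ys = [y]"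
    by (auto dest!: forward_estimate_length simp: length_Suc_conv)
  have "inits_at \<Sigma> y \<noteq> {}"
    using Nil ys by (simp add: forward_estimate_Nil[OF assms(1)])
  moreover from this have "y \<in> outputs \<Sigma>"
    using states_at_outputs[OF assms(1)] by (auto simp: inits_at_def)
  ultimately have "(inits_at \<Sigma> y, states_at \<Sigma> z) \<in> ver_inits \<Sigma>"
    using assms(2) states_at_outputs[OF assms(1,2)] unfolding ver_inits_def by blast
  then show ?case
    unfolding ys forward_estimate_Nil[OF assms(1)] by (rule ver_states.init)
next
  case (snoc u \<alpha>)
  then have "length ys = Suc (Suc (length \<alpha>))"
    by (auto dest: forward_estimate_length)
  then obtain ys' y where ys: "ys = ys' @ [y]"
    by (cases ys rule: rev_cases) auto
  note eq = forward_estimate_snoc[of \<Sigma> \<alpha> u ys' y]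
  \<comment> \<open>An empty set has no successors, so the estimate before the last letter is
    nonempty too and the induction hypothesis applies.\<close>
  have "forward_estimate \<Sigma> \<alpha> ys' \<noteq> {}" "states_at \<Sigma> y \<noteq> {}"
    using snoc.prems ys eq by (auto simp: suc_def)
  then have "(forward_estimate \<Sigma> \<alpha> ys', states_at \<Sigma> z) \<in> ver_states \<Sigma>" "y \<in> outputs \<Sigma>"
    using snoc states_at_outputs[OF assms(1)] by auto
  moreover have "u \<in> inputs \<Sigma>" using snoc by simp
  ultimately show ?case
    using snoc.prems unfolding ys
    by (intro ver_states.step[OF _ _ ver_step.forward[OF _ _ eq]]) (auto simp: ver_inputs_def)
qed

lemma estimates_ver_states:
  assumes "nfts \<Sigma>"
    and "\<alpha> \<in> lists (inputs \<Sigma>)" "forward_estimate \<Sigma> \<alpha> ys \<noteq> {}"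
    and "\<beta> \<in> lists (inputs \<Sigma>)" "backward_estimate \<Sigma> \<beta> zs \<noteq> {}"
  shows "(forward_estimate \<Sigma> \<alpha> ys, backward_estimate \<Sigma> \<beta> zs) \<in> ver_states \<Sigma>"
  using assms(4,5)
proof (induction \<beta> arbitrary: zs)
  case Nil
  then obtain z where zs: "zs = [z]"
    by (auto dest!: backward_estimate_length simp: length_Suc_conv)
  then show ?case
    using forward_estimate_ver_states[OF assms(1) _ assms(2,3)] Nil
    by (simp add: backward_estimate_Nil)
next
  case (Cons u \<beta>)
  then have "length zs = Suc (Suc (length \<beta>))"
    by (auto dest: backward_estimate_length)
  then obtain z zs' where zs: "zs = z # zs'"
    by (cases zs) auto
  note eq = backward_estimate_Cons[of \<Sigma> u \<beta> z zs']
  have "backward_estimate \<Sigma> \<beta> zs' \<noteq> {}" "states_at \<Sigma> z \<noteq> {}"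
    using Cons.prems zs eq by (auto simp: post_def)
  then have "(forward_estimate \<Sigma> \<alpha> ys, backward_estimate \<Sigma> \<beta> zs') \<in> ver_states \<Sigma>" "z \<in> outputs \<Sigma>"
    using Cons states_at_outputs[OF assms(1)] by auto
  moreover have "u \<in> inputs \<Sigma>" using Cons by simp
  ultimately show ?case
    using Cons.prems unfolding zs
    by (intro ver_states.step[OF _ _ ver_step.backward[OF _ _ eq]]) (auto simp: ver_inputs_def)
qed

section \<open>Splitting and gluing at the junction\<close>

text \<open>The path is cut at time \<open>length \<alpha>\<close>. The two observation pieces
  overlap in one entry, the output of the junction state.\<close>

lemma path_in_estimates:
  assumes "path \<Sigma> (\<alpha> @ \<beta>) xs" "xs ! 0 \<in> inits \<Sigma>"
  shows "xs ! length \<alpha> \<in> forward_estimate \<Sigma> \<alpha> (take (Suc (length \<alpha>)) (map (obs \<Sigma>) xs))"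
    and "xs ! length \<alpha> \<in> backward_estimate \<Sigma> \<beta> (drop (length \<alpha>) (map (obs \<Sigma>) xs))"
proof -
  show "xs ! length \<alpha> \<in> forward_estimate \<Sigma> \<alpha> (take (Suc (length \<alpha>)) (map (obs \<Sigma>) xs))"
    unfolding forward_estimate_def
    by (intro CollectI exI[of _ "take (Suc (length \<alpha>)) xs"])
      (use assms path_take[OF assms(1)] in \<open>auto simp: take_map\<close>)
  show "xs ! length \<alpha> \<in> backward_estimate \<Sigma> \<beta> (drop (length \<alpha>) (map (obs \<Sigma>) xs))"
    unfolding backward_estimate_def
    by (intro CollectI exI[of _ "drop (length \<alpha>) xs"])
      (use path_length[OF assms(1)] path_drop[OF assms(1)] in \<open>auto simp: drop_map\<close>)
qed

text \<open>A witness of the one membership ends in \<open>x\<close> and a witness of the other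
  starts there, so they can be glued; \<open>tl\<close> removes the second copy of the output of
  \<open>x\<close>.\<close>

lemma estimates_glue:
  assumes "x \<in> forward_estimate \<Sigma> \<alpha> ys" "x \<in> backward_estimate \<Sigma> \<beta> zs"
  obtains xs where "path \<Sigma> (\<alpha> @ \<beta>) xs" "xs ! 0 \<in> inits \<Sigma>" "xs ! length \<alpha> = x"
    "map (obs \<Sigma>) xs = ys @ tl zs"
proof -
  obtain xs where xs: "path \<Sigma> \<alpha> xs" "xs ! 0 \<in> inits \<Sigma>" "map (obs \<Sigma>) xs = ys" "x = xs ! length \<alpha>"
    using assms(1) by (auto simp: forward_estimate_def)
  obtain xs' where xs': "path \<Sigma> \<beta> xs'" "map (obs \<Sigma>) xs' = zs" "x = xs' ! 0"
    using assms(2) by (auto simp: backward_estimate_def)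
  show thesis
  proof
    show "path \<Sigma> (\<alpha> @ \<beta>) (xs @ tl xs')"
      using path_glue xs xs' by metis
  qed (use xs xs' path_length[OF xs(1)] in \<open>auto simp: nth_append map_tl\<close>)
qed

section \<open>Maximal runs in a total system, and the equivalence\<close>

lemma maximal_run_iff_path:
  assumes "total_nfts \<Sigma>" "\<alpha> \<in> lists (inputs \<Sigma>)"
  shows "maximal_run \<Sigma> \<alpha> xs \<longleftrightarrow> path \<Sigma> \<alpha> xs \<and> xs ! 0 \<in> inits \<Sigma>"
proof
  assume max: "maximal_run \<Sigma> \<alpha> xs"
  then have r: "run \<Sigma> \<alpha> xs" by (simp add: maximal_run_def)
  \<comment> \<open>\<open>run\<close> does not mention \<open>states\<close>: the first entry is
    initial and every later one is the target of a transition.\<close>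
  have states: "xs ! j \<in> states \<Sigma>" if "j < length xs" for j
    using that
  proof (cases j)
    case 0
    then show ?thesis using r assms(1) by (auto simp: run_def total_nfts_def nfts_def)
  next
    case (Suc i)
    then have "(xs ! i, \<alpha> ! i, xs ! j) \<in> transitions \<Sigma>"
      using r that by (simp add: run_def)
    then show ?thesis using assms(1) by (auto simp: total_nfts_def nfts_def)
  qed
  let ?k = "length xs - 1"
  \<comment> \<open>If the run stopped early, totality would give its last state a successor under
    the next letter, against maximality.\<close>
  have "?k = length \<alpha>"
  proof (rule ccontr)
    assume "?k \<noteq> length \<alpha>"
    then have k: "?k < length \<alpha>" using r by (simp add: run_def)
    then have "\<alpha> ! ?k \<in> inputs \<Sigma>" using assms(2) by (simp add: in_lists_conv_set)
    moreover have "xs ! ?k \<in> states \<Sigma>" using r by (intro states) (simp add: run_def)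
    ultimately have "\<exists>x'. (xs ! ?k, \<alpha> ! ?k, x') \<in> transitions \<Sigma>"
      using assms(1) by (simp add: total_nfts_def)
    then show False using max k by (auto simp: maximal_run_def Let_def)
  qed
  then have "length xs = Suc (length \<alpha>)"
    using r by (cases xs) (auto simp: run_def)
  moreover have "set xs \<subseteq> states \<Sigma>"
    using states by (auto simp: in_set_conv_nth)
  ultimately show "path \<Sigma> \<alpha> xs \<and> xs ! 0 \<in> inits \<Sigma>"
    using r by (simp add: path_def run_def)
next
  assume "path \<Sigma> \<alpha> xs \<and> xs ! 0 \<in> inits \<Sigma>"
  then show "maximal_run \<Sigma> \<alpha> xs"
    by (auto simp: path_def maximal_run_def run_def)
qed

theorem theorem5p5:
  fixes \<Sigma> :: "('x, 'u, 'y) nfts_data"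
  assumes "total_nfts \<Sigma>"
  shows "infinite_step_opaque \<Sigma> \<longleftrightarrow>
    (\<forall>(q\<^sub>1, q\<^sub>2) \<in> ver_states \<Sigma>. q\<^sub>1 \<inter> q\<^sub>2 \<noteq> {} \<longrightarrow> \<not> q\<^sub>1 \<inter> q\<^sub>2 \<subseteq> secrets \<Sigma>)"
proof -
  have nfts: "nfts \<Sigma>" using assms by (simp add: total_nfts_def)
  note max_iff = maximal_run_iff_path[OF assms]
  show ?thesis
  proof
    assume opaque: "infinite_step_opaque \<Sigma>"
    have False
      if q_ver: "(q\<^sub>1, q\<^sub>2) \<in> ver_states \<Sigma>" and x_mem: "x \<in> q\<^sub>1 \<inter> q\<^sub>2"
        and sub: "q\<^sub>1 \<inter> q\<^sub>2 \<subseteq> secrets \<Sigma>"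
      for q\<^sub>1 q\<^sub>2 x
    proof -
      obtain \<alpha> \<beta> ys zs where \<alpha>: "\<alpha> \<in> lists (inputs \<Sigma>)" and \<beta>: "\<beta> \<in> lists (inputs \<Sigma>)"
        and q: "q\<^sub>1 = forward_estimate \<Sigma> \<alpha> ys" "q\<^sub>2 = backward_estimate \<Sigma> \<beta> zs"
        using ver_states_are_estimates[OF nfts q_ver] by auto
      have x: "x \<in> forward_estimate \<Sigma> \<alpha> ys" "x \<in> backward_estimate \<Sigma> \<beta> zs" "x \<in> secrets \<Sigma>"
        using x_mem sub q by auto
      obtain xs where xs: "path \<Sigma> (\<alpha> @ \<beta>) xs" "xs ! 0 \<in> inits \<Sigma>" "xs ! length \<alpha> = x"
          "map (obs \<Sigma>) xs = ys @ tl zs"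
        using estimates_glue[OF x(1,2)] .
      have \<alpha>\<beta>: "\<alpha> @ \<beta> \<in> lists (inputs \<Sigma>)" using \<alpha> \<beta> by simp
      have "length \<alpha> < length xs" using path_length[OF xs(1)] by simp
      \<comment> \<open>Opacity is applied to the glued run at time \<open>length \<alpha>\<close>,
        where it visits the secret state \<open>x\<close>.\<close>
      then obtain xs' where xs': "path \<Sigma> (\<alpha> @ \<beta>) xs'" "xs' ! 0 \<in> inits \<Sigma>" "length xs' = length xs"
          "xs' ! length \<alpha> \<notin> secrets \<Sigma>" "\<forall>j < length xs. obs \<Sigma> (xs ! j) = obs \<Sigma> (xs' ! j)"
        using opaque \<alpha>\<beta> xs x(3) max_iff[OF \<alpha>\<beta>] unfolding infinite_step_opaque_def by blast
      then have obs_eq: "map (obs \<Sigma>) xs' = ys @ tl zs"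
        using xs(4) by (metis map_equality_iff)
      have lens: "length ys = Suc (length \<alpha>)" "length zs = Suc (length \<beta>)"
        using forward_estimate_length[OF x(1)] backward_estimate_length[OF x(2)] by auto
      have "ys ! length \<alpha> = zs ! 0"
        using forward_estimate_obs[OF x(1)] backward_estimate_obs[OF x(2)] by simp
      \<comment> \<open>What is left of \<open>ys\<close> is its last entry, which equals the head
        of \<open>zs\<close>. Hence cutting the glued observation at the junction gives back
        \<open>ys\<close> and \<open>zs\<close>, and \<open>xs'\<close> passes through the same two
        estimates.\<close>
      then have "drop (length \<alpha>) ys @ tl zs = zs"
        using lens by (cases zs; cases ys rule: rev_cases) (auto simp: nth_append)
      then have "xs' ! length \<alpha> \<in> q\<^sub>1 \<inter> q\<^sub>2"
        using path_in_estimates[OF xs'(1,2)] lens unfolding obs_eq q by simp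
      with sub xs' show False by blast
    qed
    then show "\<forall>(q\<^sub>1, q\<^sub>2) \<in> ver_states \<Sigma>. q\<^sub>1 \<inter> q\<^sub>2 \<noteq> {} \<longrightarrow> \<not> q\<^sub>1 \<inter> q\<^sub>2 \<subseteq> secrets \<Sigma>"
      by blast
  next
    assume ver: "\<forall>(q\<^sub>1, q\<^sub>2) \<in> ver_states \<Sigma>. q\<^sub>1 \<inter> q\<^sub>2 \<noteq> {} \<longrightarrow> \<not> q\<^sub>1 \<inter> q\<^sub>2 \<subseteq> secrets \<Sigma>"
    show "infinite_step_opaque \<Sigma>"
      unfolding infinite_step_opaque_def
    proof (intro ballI allI impI)
      fix \<gamma> xs i
      assume \<gamma>: "\<gamma> \<in> lists (inputs \<Sigma>)" and max: "maximal_run \<Sigma> \<gamma> xs" and i: "i < length xs"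
      have xs: "path \<Sigma> \<gamma> xs" "xs ! 0 \<in> inits \<Sigma>"
        using max max_iff[OF \<gamma>] by auto
      \<comment> \<open>The word is split at the time \<open>i\<close> of the secret visit, so that
        \<open>xs ! i\<close> becomes the junction state.\<close>
      define \<alpha> \<beta> where "\<alpha> = take i \<gamma>" and "\<beta> = drop i \<gamma>"
      have \<alpha>\<beta>: "\<gamma> = \<alpha> @ \<beta>" "length \<alpha> = i"
        using i path_length[OF xs(1)] by (auto simp: \<alpha>_def \<beta>_def)
      have lists: "\<alpha> \<in> lists (inputs \<Sigma>)" "\<beta> \<in> lists (inputs \<Sigma>)"
        using \<gamma> \<alpha>\<beta>(1) by auto
      let ?os = "map (obs \<Sigma>) xs"
      let ?F = "forward_estimate \<Sigma> \<alpha> (take (Suc i) ?os)"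
      let ?B = "backward_estimate \<Sigma> \<beta> (drop i ?os)"
      have "xs ! i \<in> ?F" "xs ! i \<in> ?B"
        using path_in_estimates[of \<Sigma> \<alpha> \<beta> xs] xs \<alpha>\<beta> by auto
      moreover from this have "(?F, ?B) \<in> ver_states \<Sigma>"
        using estimates_ver_states[OF nfts lists(1) _ lists(2)] by blast
      \<comment> \<open>The intersection contains \<open>xs ! i\<close>, so the condition on the
        verification system supplies a non-secret \<open>x\<close> in it; a run glued at
        \<open>x\<close> is the one that opacity demands.\<close>
      ultimately obtain x where x: "x \<in> ?F" "x \<in> ?B" "x \<notin> secrets \<Sigma>"
        using ver by blast
      obtain xs' where xs': "path \<Sigma> \<gamma> xs'" "xs' ! 0 \<in> inits \<Sigma>" "xs' ! i = x"
          "map (obs \<Sigma>) xs' = take (Suc i) ?os @ tl (drop i ?os)"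
        using estimates_glue[OF x(1,2)] \<alpha>\<beta> by metis
      have "map (obs \<Sigma>) xs' = ?os"
        unfolding xs'(4) by (simp only: tl_drop drop_Suc[symmetric] append_take_drop_id)
      then have "length xs' = length xs" "\<forall>j < length xs. obs \<Sigma> (xs ! j) = obs \<Sigma> (xs' ! j)"
        by (metis length_map, metis length_map nth_map)
      then show "\<exists>xs'. maximal_run \<Sigma> \<gamma> xs' \<and> length xs' = length xs \<and> xs' ! i \<notin> secrets \<Sigma> \<and>
          (\<forall>j < length xs. obs \<Sigma> (xs ! j) = obs \<Sigma> (xs' ! j))"
        using xs' x(3) max_iff[OF \<gamma>] by blast
    qed
  qed
qed

end
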